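(* Let $q=3^d$ with $d$ even, and let $\beta$ be a fixed primitive root of $\mathbb{F}_q^\times$ (a generator of the multiplicative group). Let $E\colon y^2=x^3+a_4x+a_6$ be an elliptic curve over $\mathbb{F}_q$ such that $-a_4\in\mathbb{F}_q^\times$ is not a square; equivalently $a_4\in\beta(\mathbb{F}_q^\times)^4\cup\beta^3(\mathbb{F}_q^\times)^4$. (a) If $a_4\in\beta(\mathbb{F}_q^\times)^4$ (Type IIIa), then $E$ is isomorphic over $\mathbb{F}_q$ to $y^2=x^3-\beta x$, and every elliptic curve $y^2=x^3+a_4'x+a_6'$ isomorphic to $E$ over $\mathbb{F}_q$ is also of Type IIIa. (b) If $a_4\in\beta^3(\mathbb{F}_q^\times)^4$ (Type IIIb), then $E$ is isomorphic over $\mathbb{F}_q$ to $y^2=x^3-\beta^3x$.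
   Context: $(\mathbb{F}_q^\times)^4$ denotes the subgroup of fourth powers in $\mathbb{F}_q^\times$. In characteristic $3$, every supersingular elliptic curve over $\mathbb{F}_q$ can be written as $y^2=x^3+a_4x+a_6$ with $a_4\neq0$. *)

theory Defs
  imports
    "HOL-Algebra.Algebraic_Closure_Type"
    "HOL-Computational_Algebra.Nth_Powers"
begin

text \<open>Projective varieties over \<open>K\<close> are given by their points over the algebraic closure of \<open>K\<close>;
  ``over \<open>K\<close>'' means that the defining polynomials have coefficients in \<open>K\<close>.\<close>

type_synonym 'b triple = "'b \<times> 'b \<times> 'b"

text \<open>A point of the projective plane is the set of all its homogeneous coordinate vectors.\<close>

definition proj_point :: "'b::field triple \<Rightarrow> 'b triple set" where
  "proj_point = (\<lambda>(x, y, z). {(c * x, c * y, c * z) | c. c \<noteq> 0})"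

text \<open>The coefficient of \<open>X^i Y^j Z^(n - i - j)\<close> in a form of degree \<open>n\<close> is \<open>c i j\<close>.\<close>

definition form_eval :: "nat \<Rightarrow> (nat \<Rightarrow> nat \<Rightarrow> 'a::field) \<Rightarrow> 'a alg_closure triple \<Rightarrow> 'a alg_closure" where
  "form_eval n c = (\<lambda>(x, y, z). \<Sum>i\<le>n. \<Sum>j\<le>n - i. to_ac (c i j) * x ^ i * y ^ j * z ^ (n - i - j))"

text \<open>A morphism over \<open>K\<close>: near every point, \<open>\<phi>\<close> is given by a triple of forms of equal degree
  with coefficients in \<open>K\<close>, not all vanishing at that point. On an irreducible curve, such a triple
  agrees with \<open>\<phi>\<close> wherever its entries do not all vanish.\<close>

definition morphism_over_base ::
    "'a::field alg_closure triple set set \<Rightarrow> 'a alg_closure triple set set \<Rightarrow>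
     ('a alg_closure triple set \<Rightarrow> 'a alg_closure triple set) \<Rightarrow> bool" where
  "morphism_over_base C D \<phi> \<longleftrightarrow>
     \<phi> ` C \<subseteq> D \<and>
     (\<forall>v. v \<noteq> (0, 0, 0) \<and> proj_point v \<in> C \<longrightarrow>
       (\<exists>n f g h.
         (form_eval n f v, form_eval n g v, form_eval n h v) \<noteq> (0, 0, 0) \<and>
         (\<forall>w. w \<noteq> (0, 0, 0) \<and> proj_point w \<in> C \<and>
              (form_eval n f w, form_eval n g w, form_eval n h w) \<noteq> (0, 0, 0) \<longrightarrow>
              \<phi> (proj_point w) = proj_point (form_eval n f w, form_eval n g w, form_eval n h w))))"

text \<open>The curve \<open>y^2 = x^3 + a4 x + a6\<close>, homogenised.\<close>

definition weierstrass_curve :: "'a::field \<Rightarrow> 'a \<Rightarrow> 'a alg_closure triple set set" where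
  "weierstrass_curve a4 a6 =
     {proj_point (x, y, z) | x y z.
        (x, y, z) \<noteq> (0, 0, 0) \<and> y\<^sup>2 * z = x ^ 3 + to_ac a4 * x * z\<^sup>2 + to_ac a6 * z ^ 3}"

definition point_O :: "'b::field triple set" where
  "point_O = proj_point (0, 1, 0)"

text \<open>Smoothness by the Jacobian criterion: the last three inequalities are about the partial
  derivatives of \<open>Y^2 Z - X^3 - a4 X Z^2 - a6 Z^3\<close>.\<close>

definition elliptic_curve :: "'a::field \<Rightarrow> 'a \<Rightarrow> bool" where
  "elliptic_curve a4 a6 \<longleftrightarrow>
     (\<forall>x y z. (x, y, z) \<noteq> (0, 0, 0) \<and> proj_point (x, y, z) \<in> weierstrass_curve a4 a6 \<longrightarrow>
        - 3 * x\<^sup>2 - to_ac a4 * z\<^sup>2 \<noteq> 0 \<or>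
        2 * y * z \<noteq> 0 \<or>
        y\<^sup>2 - 2 * to_ac a4 * x * z - 3 * to_ac a6 * z\<^sup>2 \<noteq> 0)"

text \<open>Isomorphism of elliptic curves over \<open>K\<close>: an isomorphism of projective curves over \<open>K\<close>
  that respects the base points.\<close>

definition isomorphic_over_base :: "'a::field \<Rightarrow> 'a \<Rightarrow> 'a \<Rightarrow> 'a \<Rightarrow> bool" where
  "isomorphic_over_base a4 a6 b4 b6 \<longleftrightarrow>
     (\<exists>\<phi> \<psi>. morphism_over_base (weierstrass_curve a4 a6) (weierstrass_curve b4 b6) \<phi> \<and>
            morphism_over_base (weierstrass_curve b4 b6) (weierstrass_curve a4 a6) \<psi> \<and>
            (\<forall>P \<in> weierstrass_curve a4 a6. \<psi> (\<phi> P) = P) \<and>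
            (\<forall>Q \<in> weierstrass_curve b4 b6. \<phi> (\<psi> Q) = Q) \<and>
            \<phi> point_O = point_O)"

definition primitive_root :: "'a::field \<Rightarrow> bool" where
  "primitive_root \<beta> \<longleftrightarrow> range (\<lambda>k::nat. \<beta> ^ k) = UNIV - {0}"

definition fourth_powers :: "'a::field set" where
  "fourth_powers = {u ^ 4 | u. u \<noteq> 0}"

definition type_IIIa :: "'a::field \<Rightarrow> 'a \<Rightarrow> bool" where
  "type_IIIa \<beta> a4 \<longleftrightarrow> a4 \<in> (\<lambda>t. \<beta> * t) ` fourth_powers"

definition type_IIIb :: "'a::field \<Rightarrow> 'a \<Rightarrow> bool" where
  "type_IIIb \<beta> a4 \<longleftrightarrow> a4 \<in> (\<lambda>t. \<beta> ^ 3 * t) ` fourth_powers"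

end

(* Over the algebraic closure, an isomorphism of Weierstrass curves fixing O maps the affine parts
   to each other. Its affine coordinates x', y' are locally fractions, hence elements of the
   coordinate ring K[x] + K[x] y. Comparing pole orders at O shows x' = c x + r and y' = e y + s x + t,
   and comparing the two equations in characteristic 3 gives s = t = 0, e^2 = c^3 and
   b4 = (e/c)^4 a4. Since the isomorphism is given by forms over F_q, it commutes with the
   q-Frobenius, which forces c and e into F_q; so the class of a4 modulo fourth powers is invariant.

   Conversely, (x, y) -> (u^2 x + r, u^3 y) multiplies a4 by u^4, and r can be chosen to kill a6
   because r -> r^3 + a4 r is additive, with trivial kernel when -a4 is not a square.

   As q = 1 mod 8, -1 is a fourth power, so it does not affect squares or fourth-power classes. *)
theory Submission
  imports Defs "HOL-Library.Product_Plus"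
begin

section \<open>Finite fields of characteristic 3\<close>

text \<open>Multiplication by a non-zero \<open>x\<close> permutes the non-zero elements, so
  comparing their products gives \<open>x ^ (q - 1) = 1\<close>.\<close>

lemma finite_field_power_card:
  fixes x :: "'a::{field,finite}"
  shows "x ^ card (UNIV :: 'a set) = x"
proof (cases "x = 0")
  case True
  have "card (UNIV :: 'a set) > 0" by (simp add: card_gt_0_iff)
  then show ?thesis using True by simp
next
  case False
  let ?A = "UNIV - {0 :: 'a}"
  have bij: "bij_betw (\<lambda>y. x * y) ?A ?A"
    by (rule bij_betwI[of _ _ _ "\<lambda>y. y / x"]) (use False in auto)
  have "(\<Prod>y\<in>?A. y) = (\<Prod>y\<in>?A. x * y)"
    using prod.reindex_bij_betw[OF bij, of "\<lambda>y. y"] by simp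
  also have "\<dots> = x ^ card ?A * (\<Prod>y\<in>?A. y)"
    by (simp add: prod.distrib)
  finally have "x ^ card ?A = 1" by simp
  moreover have "card (UNIV :: 'a set) = Suc (card ?A)"
    by (simp add: card_Diff_singleton card_gt_0_iff)
  ultimately show ?thesis by (simp only: power_Suc mult_1_right)
qed

text \<open>Translation by 1 permutes the field, so comparing sums shows that \<open>q\<close>
  copies of 1 add up to 0.\<close>

lemma finite_field_of_nat_card:
  "of_nat (card (UNIV :: 'a set)) = (0 :: 'a::{field,finite})"
proof -
  have bij: "bij_betw (\<lambda>y::'a. y + 1) UNIV UNIV"
    by (rule bij_betwI[of _ _ _ "\<lambda>y. y - 1"]) auto
  have "(\<Sum>y\<in>(UNIV::'a set). y) = (\<Sum>y\<in>UNIV. y + 1)"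
    using sum.reindex_bij_betw[OF bij, of "\<lambda>y. y"] by simp
  then show ?thesis by (simp add: sum.distrib)
qed

lemma three_eq_0_if_card:
  assumes "card (UNIV :: 'a::{field,finite} set) = 3 ^ d"
  shows "(3 :: 'a) = 0"
proof -
  have "of_nat (3 ^ d) = (0 :: 'a)"
    using finite_field_of_nat_card[where 'a='a] unfolding assms .
  then show ?thesis by (simp only: of_nat_power of_nat_numeral power_eq_0_iff)
qed

lemma frobenius_3_add:
  fixes x y :: "'a::comm_ring_1"
  assumes "(3 :: 'a) = 0"
  shows "(x + y) ^ (3 ^ n) = x ^ (3 ^ n) + y ^ (3 ^ n)"
proof (induction n)
  case (Suc n)
  have *: "(u + v) ^ 3 = u ^ 3 + v ^ 3" for u v :: 'a
  proof -
    have "(u + v) ^ 3 = u ^ 3 + v ^ 3 + 3 * (u\<^sup>2 * v + u * v\<^sup>2)"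
      by (simp add: power2_eq_square power3_eq_cube algebra_simps)
    then show ?thesis using assms by simp
  qed
  have "(x + y) ^ (3 ^ Suc n) = ((x + y) ^ (3 ^ n)) ^ 3" 
    by (simp add: power_mult[symmetric] mult.commute)
  also have "\<dots> = (x ^ (3 ^ n)) ^ 3 + (y ^ (3 ^ n)) ^ 3"
    using Suc * by simp
  finally show ?case by (simp add: power_mult[symmetric] mult.commute)
qed simp

text \<open>For even \<open>d\<close> one has \<open>q - 1 = 8 * m\<close> with
  \<open>m > 0\<close>. The square of \<open>\<beta> ^ (4 * m)\<close> is 1, and
  \<open>\<beta>\<close> has too many distinct powers for \<open>\<beta> ^ (4 * m)\<close> to be 1
  itself, so \<open>\<beta> ^ m\<close> is a fourth root of -1.\<close>

lemma neg_one_fourth_power: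
  fixes \<beta> :: "'a::{field,finite}"
  assumes "card (UNIV :: 'a set) = 3 ^ d" "even d" "primitive_root \<beta>"
  shows "\<exists>i::'a. i ^ 4 = -1"
proof -
  obtain k where k: "d = 2 * k" using \<open>even d\<close> by blast
  have "card {0, 1 :: 'a} \<le> card (UNIV :: 'a set)" by (intro card_mono) auto
  then have "d \<noteq> 0" using assms(1) by (intro notI) simp
  have "\<exists>m. (9::nat) ^ k = Suc (8 * m)"
  proof (induction k)
    case (Suc k)
    then obtain m where "(9::nat) ^ k = Suc (8 * m)" by blast
    then have "(9::nat) ^ Suc k = Suc (8 * Suc (9 * m))" by simp
    then show ?case by blast
  qed simp
  then obtain m where m: "(9::nat) ^ k = Suc (8 * m)" by blast
  have q: "3 ^ d = Suc (8 * m)" using m k by (simp add: power_mult)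
  have "m > 0" using q \<open>d \<noteq> 0\<close> by (cases "m = 0") auto
  have beta: "\<beta> \<noteq> 0" using assms(3) unfolding primitive_root_def
    by (metis Diff_iff insertCI power_one_right rangeI)
  have range: "card (range (\<lambda>k::nat. \<beta> ^ k)) = 8 * m"
    using assms(1,3) q by (simp add: primitive_root_def card_Diff_singleton)
  have "\<beta> ^ (8 * m) = 1"
    using finite_field_power_card[of \<beta>] beta assms(1) q by simp
  then have "(\<beta> ^ (4 * m))\<^sup>2 = 1" unfolding power_mult[symmetric] by (simp add: mult.commute)
  then have "\<beta> ^ (4 * m) = 1 \<or> \<beta> ^ (4 * m) = -1" by (simp add: power2_eq_1_iff)
  moreover have "\<beta> ^ (4 * m) \<noteq> 1"
  proof
    assume one: "\<beta> ^ (4 * m) = 1"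
    \<comment> \<open>Exponents could then be reduced modulo \<open>4 * m\<close>, leaving at most
      half of the \<open>8 * m\<close> non-zero elements.\<close>
    have "\<beta> ^ k \<in> (\<lambda>k. \<beta> ^ k) ` {..<4 * m}" for k
    proof -
      have "\<beta> ^ k = \<beta> ^ (4 * m * (k div (4 * m)) + k mod (4 * m))" by simp
      also have "\<dots> = \<beta> ^ (k mod (4 * m))"
        by (simp only: power_add power_mult[of \<beta> "4 * m"] one power_one mult_1)
      finally show ?thesis using \<open>m > 0\<close> by auto
    qed
    then have "range (\<lambda>k::nat. \<beta> ^ k) \<subseteq> (\<lambda>k. \<beta> ^ k) ` {..<4 * m}" by auto
    then have "card (range (\<lambda>k::nat. \<beta> ^ k)) \<le> card ((\<lambda>k. \<beta> ^ k) ` {..<4 * m})"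
      by (intro card_mono) auto
    also have "\<dots> \<le> 4 * m" using card_image_le[of "{..<4 * m}"] by simp
    finally show False using range \<open>m > 0\<close> by simp
  qed
  ultimately have "(\<beta> ^ m) ^ 4 = -1" unfolding power_mult[symmetric] by (simp add: mult.commute)
  then show ?thesis by blast
qed

section \<open>Squares, fourth powers and the two types\<close>

lemma primitive_root_not_square:
  fixes \<beta> w :: "'a::{field,finite}"
  assumes "(2 :: 'a) \<noteq> 0" "primitive_root \<beta>"
  shows "\<beta> \<noteq> w\<^sup>2"
proof
  assume eq: "\<beta> = w\<^sup>2"
  \<comment> \<open>A square generator makes every element a square; on a finite field squaring is
    then injective, although 1 and -1 have the same square.\<close>
  have "z \<in> range (\<lambda>x. x\<^sup>2)" for z :: 'a
  proof (cases "z = 0")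
    case True
    then show ?thesis by (intro image_eqI[of _ _ 0]) auto
  next
    case False
    then have "z \<in> range (\<lambda>k::nat. \<beta> ^ k)" using assms(2) by (simp add: primitive_root_def)
    then obtain k where "z = \<beta> ^ k" by blast
    then have "z = (w ^ k)\<^sup>2" by (simp add: eq power_mult[symmetric] mult.commute)
    then show ?thesis by blast
  qed
  then have "surj (\<lambda>x::'a. x\<^sup>2)" by blast
  then have "inj (\<lambda>x::'a. x\<^sup>2)" by (rule finite_UNIV_surj_inj[OF finite])
  then have "1 = (-1 :: 'a)" by (rule injD) simp
  then have "(2 :: 'a) = 0" by (metis add.left_inverse one_add_one)
  with assms(1) show False by simp
qed

text \<open>Write \<open>a = \<beta> ^ k\<close>. Since -1 is a fourth power, \<open>- a\<close> is
  a non-square exactly for odd \<open>k\<close>, and \<open>k mod 4\<close> then decides between the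
  two types.\<close>

lemma nonsquare_iff_type_III:
  fixes \<beta> a :: "'a::{field,finite}"
  assumes "(2 :: 'a) \<noteq> 0" "i ^ 4 = (-1 :: 'a)" "primitive_root \<beta>" "a \<noteq> 0"
  shows "\<not> is_square (- a) \<longleftrightarrow> type_IIIa \<beta> a \<or> type_IIIb \<beta> a"
proof -
  have sq: "is_square z \<longleftrightarrow> (\<exists>w. z = w\<^sup>2)" for z :: 'a
    by (auto simp: is_nth_power_def)
  have beta: "\<beta> \<noteq> 0" using assms(3) unfolding primitive_root_def
    by (metis Diff_iff insertCI power_one_right rangeI)
  have i: "i \<noteq> 0" using assms(2) by auto
  have neg: "- z = i ^ 4 * z" for z using assms(2) by simp
  have "\<not> is_square (- a)" if t: "type_IIIa \<beta> a"
  proof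
    assume "is_square (- a)"
    then obtain w where w: "- a = w\<^sup>2" by (auto simp: sq)
    from t obtain u where u: "u \<noteq> 0" "a = \<beta> * u ^ 4"
      by (auto simp: type_IIIa_def fourth_powers_def)
    have "\<beta> = (w / (i\<^sup>2 * u\<^sup>2))\<^sup>2"
      using w u i unfolding neg[of a] by (simp add: field_simps power2_eq_square power4_eq_xxxx)
    then show False using primitive_root_not_square[OF assms(1,3)] by blast
  qed
  moreover have "\<not> is_square (- a)" if t: "type_IIIb \<beta> a"
  proof
    assume "is_square (- a)"
    then obtain w where w: "- a = w\<^sup>2" by (auto simp: sq)
    from t obtain u where u: "u \<noteq> 0" "a = \<beta> ^ 3 * u ^ 4"
      by (auto simp: type_IIIb_def fourth_powers_def)
    \<comment> \<open>From \<open>i ^ 4 * \<beta> ^ 3 * u ^ 4 = w\<^sup>2\<close>: the extra factor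
      \<open>\<beta>\<^sup>2\<close> is itself a square and is divided out.\<close>
    have "\<beta> = (w / (i\<^sup>2 * u\<^sup>2 * \<beta>))\<^sup>2"
      using w u i beta unfolding neg[of a]
      by (simp add: field_simps power2_eq_square power3_eq_cube power4_eq_xxxx)
    then show False using primitive_root_not_square[OF assms(1,3)] by blast
  qed
  moreover have "type_IIIa \<beta> a \<or> type_IIIb \<beta> a" if ns: "\<not> is_square (- a)"
  proof -
    have "a \<in> range (\<lambda>k::nat. \<beta> ^ k)" using assms(3,4) by (simp add: primitive_root_def)
    then obtain k where k: "a = \<beta> ^ k" by blast
    have "odd k"
    proof
      assume "even k"
      then obtain j where "k = 2 * j" by blast
      then have "- a = i ^ 4 * \<beta> ^ (j * 2)" using neg k by (metis mult.commute)
      then have "- a = (i\<^sup>2 * \<beta> ^ j)\<^sup>2"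
        by (simp add: power_mult_distrib flip: power_mult)
      then show False using ns sq by blast
    qed
    then have "k mod 4 = 1 \<or> k mod 4 = 3" by presburger
    moreover have "a = \<beta> ^ (k mod 4) * (\<beta> ^ (k div 4)) ^ 4"
    proof -
      have "\<beta> ^ k = \<beta> ^ (k mod 4 + k div 4 * 4)" by simp
      then show ?thesis unfolding k power_add power_mult .
    qed
    moreover have "(\<beta> ^ (k div 4)) ^ 4 \<in> fourth_powers"
      using beta unfolding fourth_powers_def by (intro CollectI exI[of _ "\<beta> ^ (k div 4)"]) simp
    ultimately show ?thesis
      unfolding type_IIIa_def type_IIIb_def by (metis image_eqI power_one_right)
  qed
  ultimately show ?thesis by blast
qed

section \<open>The coordinate ring of an affine cubic\<close>

text \<open>If the field were finite, adding 1 to the product of all \<open>X - a\<close> would give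
  a non-constant polynomial without roots.\<close>

lemma infinite_UNIV_alg_closed:
  "infinite (UNIV :: 'b::alg_closed_field set)"
proof
  assume fin: "finite (UNIV :: 'b set)"
  define p :: "'b poly" where "p = (\<Prod>a\<in>UNIV. [:- a, 1:])"
  have root: "poly p x = 0" for x
    unfolding p_def poly_prod by (intro prod_zero) (auto simp: fin intro!: bexI[of _ x])
  have "p \<noteq> 0" by (simp add: p_def fin)
  have "degree p \<noteq> 0"
  proof
    assume "degree p = 0"
    then obtain c where "p = [:c:]" by (rule degree_eq_zeroE)
    then show False using root[of 0] \<open>p \<noteq> 0\<close> by simp
  qed
  then have "degree (p + 1) > 0" by (simp add: degree_add_eq_left)
  then obtain x where "poly (p + 1) x = 0" using alg_closed_imp_poly_has_root by blast
  then show False using root[of x] by simp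
qed

lemma poly_eqI_alg_closed:
  fixes p q :: "'b::alg_closed_field poly"
  assumes "\<And>x. poly p x = poly q x"
  shows "p = q"
proof (rule ccontr)
  assume "p \<noteq> q"
  then have "finite {x. poly (p - q) x = 0}" by (intro poly_roots_finite) simp
  moreover have "{x. poly (p - q) x = 0} = UNIV" using assms by simp
  ultimately show False using infinite_UNIV_alg_closed[where 'b='b] by simp
qed

lemma square_root_exists: "\<exists>y::'b::alg_closed_field. y\<^sup>2 = c"
  using nth_root_exists[of 2 c] by simp

text \<open>A pair \<open>(A, B)\<close> stands for \<open>A(x) + B(x) y\<close> in the coordinate ring \<open>K[x, y] / (y\<^sup>2 - f(x))\<close> of a
  cubic \<open>f\<close>, where \<open>x\<close> and \<open>y\<close> have poles of order 2 and 3 at infinity.\<close>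

definition ev :: "'b::comm_ring_1 poly \<times> 'b poly \<Rightarrow> 'b \<Rightarrow> 'b \<Rightarrow> 'b" where
  "ev u x y = poly (fst u) x + poly (snd u) x * y"

text \<open>The contribution of \<open>A\<close> is even and that of \<open>B y\<close> is odd, so
  the two poles never cancel and the maximum is the true order. The zero element gets order 0, like
  the constants.\<close>

definition pole_order :: "'b::comm_ring_1 poly \<times> 'b poly \<Rightarrow> nat" where
  "pole_order u = max (2 * degree (fst u)) (if snd u = 0 then 0 else 2 * degree (snd u) + 3)"

lemma ev_add: "ev (u + v) x y = ev u x y + ev v x y"
  by (simp add: ev_def algebra_simps)

lemma ev_const [simp]: "ev ([:c:], 0) x y = c"
  by (simp add: ev_def)

lemma pole_order_const [simp]: "pole_order ([:c:], 0) = 0"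
  by (simp add: pole_order_def)

lemma pole_order_0 [simp]: "pole_order 0 = 0"
  by (simp add: pole_order_def)

lemma pole_order_eq_0_iff: "pole_order u = 0 \<longleftrightarrow> (\<exists>c. u = ([:c:], 0))"
  by (cases u) (auto simp: pole_order_def elim: degree_eq_zeroE split: if_splits)

lemma pole_order_uminus [simp]: "pole_order (- u) = pole_order u"
  by (simp add: pole_order_def)

lemma pole_order_add_le: "pole_order (u + v) \<le> max (pole_order u) (pole_order v)"
proof -
  have "degree (fst u + fst v) \<le> max (degree (fst u)) (degree (fst v))"
    "degree (snd u + snd v) \<le> max (degree (snd u)) (degree (snd v))"
    by (simp_all add: degree_add_le_max)
  then show ?thesis
    by (auto simp: pole_order_def max_def split: if_splits)
qed

text \<open>The strict case of the ultrametric inequality, obtained by applying the inequality again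
  to \<open>v = (u + v) + (- u)\<close>.\<close>

lemma pole_order_add_less:
  assumes "pole_order u < pole_order v"
  shows "pole_order (u + v) = pole_order v"
proof (rule antisym)
  show "pole_order (u + v) \<le> pole_order v"
    using pole_order_add_le[of u v] assms by simp
  have "pole_order v \<le> max (pole_order (u + v)) (pole_order u)"
    using pole_order_add_le[of "u + v" "- u"] by simp
  then show "pole_order v \<le> pole_order (u + v)" using assms by simp
qed

locale cubic =
  fixes f :: "'b::alg_closed_field poly"
  assumes degree_f: "degree f = 3" and two: "(2 :: 'b) \<noteq> 0"
begin

definition mul :: "'b poly \<times> 'b poly \<Rightarrow> 'b poly \<times> 'b poly \<Rightarrow> 'b poly \<times> 'b poly" where
  "mul u v = (fst u * fst v + f * snd u * snd v, fst u * snd v + snd u * fst v)"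

text \<open>The norm to \<open>K[x]\<close>; its degree is the pole order, which is therefore additive.\<close>

definition nrm :: "'b poly \<times> 'b poly \<Rightarrow> 'b poly" where
  "nrm u = (fst u)\<^sup>2 - f * (snd u)\<^sup>2"

lemma f_nonzero: "f \<noteq> 0"
  using degree_f by auto

lemma ev_mul:
  assumes "y\<^sup>2 = poly f x"
  shows "ev (mul u v) x y = ev u x y * ev v x y"
  by (simp add: ev_def mul_def algebra_simps power2_eq_square flip: assms)

text \<open>Adding the values at \<open>(x, y)\<close> and \<open>(x, -y)\<close> gives
  \<open>A(x) = 0\<close>, hence \<open>B(x) y = 0\<close>. As \<open>y\<close> may vanish, the
  conclusion is drawn for \<open>f B\<^sup>2\<close> first and then for \<open>B\<close>.\<close>

lemma ev_eq_0D:
  assumes "\<And>x y. y\<^sup>2 = poly f x \<Longrightarrow> ev u x y = 0"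
  shows "u = 0"
proof -
  have *: "poly (fst u) x = 0 \<and> poly (f * (snd u)\<^sup>2) x = 0" for x
  proof -
    obtain y where y: "y\<^sup>2 = poly f x" using square_root_exists by blast
    have p: "poly (fst u) x + poly (snd u) x * y = 0"
      using assms[OF y] by (simp add: ev_def)
    have m: "poly (fst u) x - poly (snd u) x * y = 0"
      using assms[of "- y" x] y by (simp add: ev_def)
    have "2 * poly (fst u) x = 0"
      using arg_cong2[OF p m, of "(+)"] by (simp add: algebra_simps)
    then have "poly (fst u) x = 0" using two by simp
    moreover from this p have "poly (snd u) x = 0 \<or> y = 0" by simp
    ultimately show ?thesis by (auto simp flip: y)
  qed
  have "fst u = 0" by (rule poly_eqI_alg_closed) (simp add: *)
  moreover have "f * (snd u)\<^sup>2 = 0"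
    by (rule poly_eqI_alg_closed) (use * in simp)
  ultimately show ?thesis using f_nonzero by (simp add: prod_eq_iff)
qed

lemma ev_inject:
  assumes "\<And>x y. y\<^sup>2 = poly f x \<Longrightarrow> ev u x y = ev v x y"
  shows "u = v"
proof -
  have "u - v = 0" by (rule ev_eq_0D) (use assms in \<open>simp add: ev_def algebra_simps\<close>)
  then show ?thesis by simp
qed

lemma nrm_mul: "nrm (mul u v) = nrm u * nrm v"
  by (simp add: nrm_def mul_def algebra_simps power2_eq_square)

text \<open>\<open>A\<^sup>2\<close> has even degree and \<open>f B\<^sup>2\<close> odd degree, so
  their leading terms cannot cancel.\<close>

lemma degree_nrm:
  assumes "u \<noteq> 0"
  shows "nrm u \<noteq> 0" "degree (nrm u) = pole_order u"
proof -
  have 1: "degree ((fst u)\<^sup>2) = 2 * degree (fst u)" 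
    by (cases "fst u = 0") (simp_all add: degree_power_eq)
  have 2: "degree (f * (snd u)\<^sup>2) = 2 * degree (snd u) + 3" if "snd u \<noteq> 0"
    using that f_nonzero degree_f by (simp add: degree_mult_eq degree_power_eq)
  have "nrm u \<noteq> 0 \<and> degree (nrm u) = pole_order u"
  proof (cases "snd u = 0")
    case True
    then show ?thesis using assms 1 by (simp add: nrm_def pole_order_def prod_eq_iff)
  next
    case False
    have "degree ((fst u)\<^sup>2) \<noteq> degree (f * (snd u)\<^sup>2)"
      unfolding 1 2[OF False] by presburger
    then consider "degree ((fst u)\<^sup>2) < degree (- (f * (snd u)\<^sup>2))"
      | "degree (- (f * (snd u)\<^sup>2)) < degree ((fst u)\<^sup>2)" by fastforce
    then have "degree ((fst u)\<^sup>2 + (- (f * (snd u)\<^sup>2))) = max (2 * degree (fst u)) (2 * degree (snd u) + 3)"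
    proof cases
      case lt: 1
      then show ?thesis unfolding degree_add_eq_right[OF lt] using 1 2[OF False] by simp
    next
      case gt: 2
      then show ?thesis unfolding degree_add_eq_left[OF gt] using 1 2[OF False] by simp
    qed
    then have "degree (nrm u) = pole_order u" "pole_order u \<noteq> 0"
      using False by (simp_all add: nrm_def pole_order_def)
    then show ?thesis by auto
  qed
  then show "nrm u \<noteq> 0" "degree (nrm u) = pole_order u" by auto
qed

lemma pole_order_mul:
  assumes "u \<noteq> 0" "v \<noteq> 0"
  shows "mul u v \<noteq> 0" "pole_order (mul u v) = pole_order u + pole_order v"
proof -
  have n: "nrm (mul u v) \<noteq> 0" using degree_nrm(1) assms by (simp add: nrm_mul)
  then show "mul u v \<noteq> 0" by (auto simp: nrm_def)
  then show "pole_order (mul u v) = pole_order u + pole_order v"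
    using assms degree_nrm by (metis degree_mult_eq nrm_mul)
qed

text \<open>Horner's scheme inside the coordinate ring: each step multiplies by \<open>u\<close> and
  adds a constant, whose order 0 is below that of the product because \<open>u\<close> has a
  pole.\<close>

lemma pole_order_compose_poly:
  assumes "pole_order u > 0" "p \<noteq> 0"
  shows "\<exists>w. w \<noteq> 0 \<and> pole_order w = degree p * pole_order u \<and>
    (\<forall>x y. y\<^sup>2 = poly f x \<longrightarrow> ev w x y = poly p (ev u x y))"
  using assms(2)
proof (induction p)
  case (pCons a p)
  show ?case
  proof (cases "p = 0")
    case True
    then show ?thesis using pCons.hyps by (intro exI[of _ "([:a:], 0)"]) (simp add: zero_prod_def)
  next
    case False
    then obtain w where w: "w \<noteq> 0" "pole_order w = degree p * pole_order u"
      "\<And>x y. y\<^sup>2 = poly f x \<Longrightarrow> ev w x y = poly p (ev u x y)"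
      using pCons.IH by blast
    have "u \<noteq> 0" using assms(1) by (auto simp: pole_order_def)
    then have d: "pole_order (mul u w) = pole_order u + degree p * pole_order u"
      using pole_order_mul(2) w by simp
    let ?w = "([:a:], 0) + mul u w"
    have d': "pole_order ?w = pole_order u + degree p * pole_order u"
      using pole_order_add_less[of "([:a:], 0)" "mul u w"] d assms(1) by simp
    then have "?w \<noteq> 0" using assms(1) by (metis add_is_0 not_gr_zero pole_order_0)
    moreover have "ev ?w x y = poly (pCons a p) (ev u x y)" if "y\<^sup>2 = poly f x" for x y
      unfolding ev_add ev_mul[OF that] using w(3)[OF that] by simp
    ultimately show ?thesis using d' False by (intro exI[of _ ?w]) simp
  qed
qed simp

text \<open>The part without \<open>v\<close> has order \<open>k\<close> times an even number and
  the part with \<open>v\<close> order \<open>k\<close> times an odd number. They cannot cancel, so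
  the order of the sum is one of the two.\<close>

lemma pole_order_compose_ev:
  assumes "pole_order u = 2 * k" "pole_order v = 3 * k" "k > 0"
  shows "\<exists>w. k dvd pole_order w \<and>
    (\<forall>x y. y\<^sup>2 = poly f x \<longrightarrow> ev w x y = ev s (ev u x y) (ev v x y))"
proof -
  have u: "pole_order u > 0" and v: "v \<noteq> 0" using assms by (auto simp: pole_order_def)
  have "\<exists>a. (a \<noteq> 0 \<longrightarrow> pole_order a = 2 * k * degree p) \<and> (p = 0 \<longrightarrow> a = 0) \<and>
    (\<forall>x y. y\<^sup>2 = poly f x \<longrightarrow> ev a x y = poly p (ev u x y))" for p
  proof (cases "p = 0")
    case True
    then show ?thesis by (intro exI[of _ 0]) (simp add: ev_def)
  next
    case False
    then show ?thesis using pole_order_compose_poly[OF u False] assms by (auto simp: mult.commute)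
  qed note comp = this
  obtain a where a: "a \<noteq> 0 \<Longrightarrow> pole_order a = 2 * k * degree (fst s)"
    "\<And>x y. y\<^sup>2 = poly f x \<Longrightarrow> ev a x y = poly (fst s) (ev u x y)"
    using comp[of "fst s"] by blast
  obtain b where b: "b \<noteq> 0 \<Longrightarrow> pole_order b = 2 * k * degree (snd s)"
    "\<And>x y. y\<^sup>2 = poly f x \<Longrightarrow> ev b x y = poly (snd s) (ev u x y)"
    using comp[of "snd s"] by blast
  let ?w = "a + mul b v"
  have "k dvd pole_order ?w"
  proof (cases "b = 0 \<or> a = 0")
    case True
    have "k dvd pole_order a" using a(1) by (cases "a = 0") (auto simp: pole_order_def)
    moreover have "k dvd pole_order (mul b v)"
      using b(1) assms pole_order_mul[of b v] v
      by (cases "b = 0") (auto simp: pole_order_def mul_def)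
    moreover have "mul 0 v = 0" by (simp add: mul_def zero_prod_def)
    ultimately show ?thesis using True by auto
  next
    case False
    then have m: "pole_order (mul b v) = k * (2 * degree (snd s) + 3)"
      using b(1) assms pole_order_mul[of b v] v by (simp add: algebra_simps)
    have n: "pole_order a = k * (2 * degree (fst s))" using a(1) False by simp
    have "2 * degree (fst s) \<noteq> 2 * degree (snd s) + 3" by presburger
    then have "pole_order a \<noteq> pole_order (mul b v)" unfolding m n using assms(3) by simp
    then consider "pole_order a < pole_order (mul b v)" | "pole_order (mul b v) < pole_order a"
      by linarith
    then show ?thesis
    proof cases
      case 1
      show ?thesis unfolding pole_order_add_less[OF 1] m by simp
    next
      case 2
      show ?thesis using pole_order_add_less[OF 2] n by (simp add: add.commute)
    qed
  qed
  moreover have "ev ?w x y = ev s (ev u x y) (ev v x y)" if "y\<^sup>2 = poly f x" for x y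
    unfolding ev_add ev_mul[OF that] a(2)[OF that] b(2)[OF that] by (simp add: ev_def)
  ultimately show ?thesis by blast
qed

text \<open>The pole orders of \<open>u\<close> and \<open>v\<close> are \<open>2 k\<close> and \<open>3 k\<close>, so every function in \<open>K[u, v]\<close> has a pole
  order divisible by \<open>k\<close>; as \<open>K[u, v]\<close> contains \<open>x\<close> and \<open>y\<close>, \<open>k = 1\<close>.\<close>

lemma invertible_coordinate_change_affine:
  assumes g: "degree g = 3"
    and rel: "\<And>x y. y\<^sup>2 = poly f x \<Longrightarrow> (ev v x y)\<^sup>2 = poly g (ev u x y)"
    and x: "\<And>x y. y\<^sup>2 = poly f x \<Longrightarrow> ev s (ev u x y) (ev v x y) = x"
    and y: "\<And>x y. y\<^sup>2 = poly f x \<Longrightarrow> ev t (ev u x y) (ev v x y) = y"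
  obtains c r a b e where "c \<noteq> 0" "e \<noteq> 0" "u = ([:r, c:], 0)" "v = ([:b, a:], [:e:])"
proof -
  have vv: "pole_order (mul v v) = 2 * pole_order v"
    using pole_order_mul[of v v] by (cases "v = 0") (simp_all add: mul_def pole_order_def)
  \<comment> \<open>A constant \<open>u\<close> makes \<open>v\<^sup>2 = g(u)\<close> constant,
    hence \<open>v\<close> too; but then \<open>s(u, v)\<close> could not equal \<open>x\<close> at
    both \<open>x = 0\<close> and \<open>x = 1\<close>.\<close>
  have "pole_order u \<noteq> 0"
  proof
    assume "pole_order u = 0"
    then obtain r where r: "u = ([:r:], 0)" by (auto simp: pole_order_eq_0_iff)
    have "mul v v = ([:poly g r:], 0)"
      by (rule ev_inject) (use rel r in \<open>simp add: ev_mul power2_eq_square\<close>)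
    then have "pole_order v = 0" using vv by simp
    then obtain b where "v = ([:b:], 0)" by (auto simp: pole_order_eq_0_iff)
    then have const: "x = ev s r b" if "y\<^sup>2 = poly f x" for x y using x[OF that] r by simp
    obtain y0 y1 where "y0\<^sup>2 = poly f 0" "y1\<^sup>2 = poly f 1" using square_root_exists by metis
    then show False using const[of y0 0] const[of y1 1] by simp
  qed
  then have u: "pole_order u > 0" by simp
  obtain w where w: "pole_order w = 3 * pole_order u"
      "\<And>x y. y\<^sup>2 = poly f x \<Longrightarrow> ev w x y = poly g (ev u x y)"
    using pole_order_compose_poly[OF u, of g] g by fastforce
  \<comment> \<open>The relation \<open>v\<^sup>2 = g(u)\<close> holds in the coordinate ring, and
    comparing pole orders gives \<open>2 ord v = 3 ord u\<close>.\<close>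
  have "mul v v = w" by (rule ev_inject) (use rel w in \<open>simp add: ev_mul power2_eq_square\<close>)
  then have uv: "2 * pole_order v = 3 * pole_order u" using vv w by simp
  define k where "k = pole_order v - pole_order u"
  have k: "pole_order u = 2 * k" "pole_order v = 3 * k" "k > 0"
    using uv u by (auto simp: k_def)
  obtain p where p: "k dvd pole_order p"
    "\<And>x y. y\<^sup>2 = poly f x \<Longrightarrow> ev p x y = ev s (ev u x y) (ev v x y)"
    using pole_order_compose_ev[OF k, of s] by blast
  obtain q where q: "k dvd pole_order q"
    "\<And>x y. y\<^sup>2 = poly f x \<Longrightarrow> ev q x y = ev t (ev u x y) (ev v x y)"
    using pole_order_compose_ev[OF k, of t] by blast
  \<comment> \<open>\<open>p\<close> and \<open>q\<close> are the functions \<open>x\<close> and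
    \<open>y\<close>, of orders 2 and 3, and \<open>k\<close> divides both.\<close>
  have "p = ([:0, 1:], 0)" by (rule ev_inject) (simp add: p(2) x, simp add: ev_def)
  moreover have "q = (0, 1)" by (rule ev_inject) (simp add: q(2) y, simp add: ev_def)
  ultimately have "k dvd 2" "k dvd 3" using p(1) q(1) by (simp_all add: pole_order_def)
  then have "k dvd 3 - 2" by (intro dvd_diff_nat)
  then have "k = 1" by simp
  then have "pole_order u = 2" "pole_order v = 3" using k by simp_all
  obtain U U' where U: "u = (U, U')" by (cases u)
  obtain V V' where V: "v = (V, V')" by (cases v)
  have "U' = 0" "degree U = 1"
    using \<open>pole_order u = 2\<close> by (auto simp: U pole_order_def max_def split: if_splits)
  \<comment> \<open>The odd order 3 can only come from the \<open>y\<close> component, which is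
    therefore a non-zero constant.\<close>
  have "2 * degree V \<noteq> 3" by presburger
  then have "V' \<noteq> 0" "degree V' = 0" "degree V \<le> 1"
    using \<open>pole_order v = 3\<close> by (auto simp: V pole_order_def max_def split: if_splits)
  have lin: "\<exists>b a. p = [:b, a:]" if "degree p \<le> 1" for p :: "'b poly"
    using that by (intro exI[of _ "coeff p 0"] exI[of _ "coeff p 1"])
      (auto intro!: poly_eqI simp: coeff_pCons coeff_eq_0 split: nat.splits)
  obtain r c where "U = [:r, c:]" using lin[of U] \<open>degree U = 1\<close> by auto
  moreover obtain b a where "V = [:b, a:]" using lin[OF \<open>degree V \<le> 1\<close>] by blast
  moreover obtain e where "V' = [:e:]" using \<open>degree V' = 0\<close> by (rule degree_eq_zeroE)
  ultimately show thesis
    using that[of c e r b a] U V \<open>U' = 0\<close> \<open>degree U = 1\<close> \<open>V' \<noteq> 0\<close> by (auto split: if_splits)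
qed

section \<open>Regular functions on the affine curve\<close>

definition regular :: "('b \<Rightarrow> 'b \<Rightarrow> 'b) \<Rightarrow> bool" where
  "regular F \<longleftrightarrow> (\<exists>u. \<forall>x y. y\<^sup>2 = poly f x \<longrightarrow> F x y = ev u x y)"

lemma regular_ev: "regular (ev u)"
  unfolding regular_def by blast

lemma regular_poly: "regular (\<lambda>x y. poly p x)"
  unfolding regular_def by (intro exI[of _ "(p, 0)"]) (simp add: ev_def)

lemma regular_y: "regular (\<lambda>x y. y)"
  unfolding regular_def by (intro exI[of _ "(0, 1)"]) (simp add: ev_def)

lemma regular_const: "regular (\<lambda>x y. c)"
  using regular_poly[of "[:c:]"] by simp

lemma regular_x: "regular (\<lambda>x y. x)"
  using regular_poly[of "[:0, 1:]"] by simp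

lemma regular_add: "regular F \<Longrightarrow> regular G \<Longrightarrow> regular (\<lambda>x y. F x y + G x y)"
  unfolding regular_def by (metis ev_add)

lemma regular_mult: "regular F \<Longrightarrow> regular G \<Longrightarrow> regular (\<lambda>x y. F x y * G x y)"
  unfolding regular_def by (metis ev_mul)

lemma regular_power: "regular F \<Longrightarrow> regular (\<lambda>x y. F x y ^ n)"
  by (induction n) (simp_all add: regular_const regular_mult)

lemma regular_sum:
  assumes "\<And>i. i \<in> I \<Longrightarrow> regular (F i)"
  shows "regular (\<lambda>x y. \<Sum>i\<in>I. F i x y)"
  using assms by (induction I rule: infinite_finite_induct) (simp_all add: regular_const regular_add)

lemma ev_conj:
  assumes "y\<^sup>2 = poly f x"
  shows "ev u x y * ev u x (- y) = poly (nrm u) x"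
  by (simp add: ev_def nrm_def algebra_simps power2_eq_square flip: assms)

text \<open>The polynomials in \<open>x\<close> among the denominators of \<open>F\<close> form an ideal; its generator
  has no root \<open>x\<close>, because the norm of a denominator that vanishes at neither \<open>(x, y)\<close> nor
  \<open>(x, -y)\<close> lies in the ideal and does not vanish at \<open>x\<close>.\<close>

lemma regular_if_locally_fraction:
  assumes loc: "\<And>x y. y\<^sup>2 = poly f x \<Longrightarrow>
    \<exists>h. regular h \<and> h x y \<noteq> 0 \<and> regular (\<lambda>x y. F x y * h x y)"
  shows "regular F"
proof -
  define den where "den u \<longleftrightarrow> regular (\<lambda>x y. F x y * ev u x y)" for u
  define S where "S = {p. p \<noteq> 0 \<and> regular (\<lambda>x y. F x y * poly p x)}"
  have den_at: "\<exists>u. den u \<and> ev u x y \<noteq> 0" if on: "y\<^sup>2 = poly f x" for x y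
  proof -
    obtain h u where h: "h x y \<noteq> 0" "regular (\<lambda>x y. F x y * h x y)"
      and u: "\<And>x y. y\<^sup>2 = poly f x \<Longrightarrow> h x y = ev u x y"
      using loc[OF on] unfolding regular_def by blast
    have "den u" using h(2) u unfolding den_def regular_def by metis
    then show ?thesis using h(1) u[OF on] by metis
  qed
  have den_add: "den (u + v)" if "den u" "den v" for u v
    using regular_add[OF that[unfolded den_def]] by (simp add: den_def ev_add distrib_left)
  have den_nrm: "regular (\<lambda>x y. F x y * poly (nrm u) x)" if "den u" for u
  proof -
    \<comment> \<open>Multiplying by the conjugate turns a denominator into a polynomial in
      \<open>x\<close>, its norm.\<close>
    have "regular (\<lambda>x y. F x y * ev u x y * ev (fst u, - snd u) x y)"
      using that regular_ev unfolding den_def by (rule regular_mult)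
    moreover have "ev u x y * ev (fst u, - snd u) x y = poly (nrm u) x" if "y\<^sup>2 = poly f x" for x y
      using ev_conj[OF that, of u] by (simp add: ev_def)
    ultimately show ?thesis unfolding regular_def by (simp add: mult.assoc)
  qed
  obtain y1 where y1: "y1\<^sup>2 = poly f 0" using square_root_exists by blast
  obtain u1 where "den u1" "ev u1 0 y1 \<noteq> 0" using den_at[OF y1] by blast
  moreover from this have "u1 \<noteq> 0" by (auto simp: ev_def)
  ultimately have "nrm u1 \<in> S" using den_nrm degree_nrm(1) by (simp add: S_def)
  \<comment> \<open>A non-zero element of least degree generates the ideal of polynomial
    denominators.\<close>
  then obtain p where p: "p \<in> S" "\<And>q. q \<in> S \<Longrightarrow> degree p \<le> degree q"
    using ex_has_least_nat[of "\<lambda>p. p \<in> S" _ degree] by blast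
  have "degree p = 0"
  proof (rule ccontr)
    assume "degree p \<noteq> 0"
    then obtain x where x: "poly p x = 0" using alg_closed_imp_poly_has_root[of p] by blast
    obtain y where y: "y\<^sup>2 = poly f x" using square_root_exists by blast
    then have y': "(- y)\<^sup>2 = poly f x" by simp
    obtain v w where v: "den v" "ev v x y \<noteq> 0" and w: "den w" "ev w x (- y) \<noteq> 0"
      using den_at[OF y] den_at[OF y'] by blast
    \<comment> \<open>If \<open>v\<close> vanishes at \<open>(x, -y)\<close> and \<open>w\<close> at
      \<open>(x, y)\<close>, then \<open>v + w\<close> vanishes at neither point.\<close>
    have "\<exists>u. den u \<and> ev u x y \<noteq> 0 \<and> ev u x (- y) \<noteq> 0"
    proof (cases "ev v x (- y) \<noteq> 0 \<or> ev w x y \<noteq> 0")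
      case True
      then show ?thesis using v w by blast
    next
      case False
      then show ?thesis using v w den_add[of v w] by (intro exI[of _ "v + w"]) (simp add: ev_add)
    qed
    then obtain u where u: "den u" "poly (nrm u) x \<noteq> 0" using ev_conj[OF y] by (metis mult_eq_0_iff)
    \<comment> \<open>The remainder stays in the ideal and is non-zero, since it agrees with the
      norm at the root \<open>x\<close> of \<open>p\<close>; its smaller degree contradicts
      minimality.\<close>
    let ?q = "nrm u mod p"
    have q: "poly ?q z = poly (nrm u) z + poly (- (nrm u div p)) z * poly p z" for z
      by (simp add: minus_div_mult_eq_mod[symmetric])
    have "regular (\<lambda>x y. F x y * poly p x)" using p(1) by (simp add: S_def)
    then have "regular (\<lambda>x y. F x y * poly (nrm u) x + poly (- (nrm u div p)) x * (F x y * poly p x))"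
      by (rule regular_add[OF den_nrm[OF u(1)] regular_mult[OF regular_poly]])
    then have "regular (\<lambda>x y. F x y * poly ?q x)" unfolding q by (simp add: algebra_simps)
    moreover have "?q \<noteq> 0" using q[of x] x u(2) by auto
    ultimately have "?q \<in> S" by (simp add: S_def)
    then have "degree p \<le> degree ?q" by (rule p(2))
    moreover have "degree ?q < degree p"
      using \<open>?q \<noteq> 0\<close> p(1) by (intro degree_mod_less') (auto simp: S_def)
    ultimately show False by simp
  qed
  then obtain c where c: "p = [:c:]" by (rule degree_eq_zeroE)
  then have "c \<noteq> 0" and "regular (\<lambda>x y. F x y * c)" using p(1) by (auto simp: S_def)
  then show ?thesis using regular_mult[OF _ regular_const[of "1 / c"]] by fastforce
qed

end

section \<open>Isomorphisms are affine\<close>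

lemma proj_point_mem: "v \<in> proj_point v"
  by (cases v) (auto simp: proj_point_def intro!: exI[of _ 1])

lemma proj_point_eqD:
  assumes "proj_point (x, y, z) = proj_point (x', y', z')"
  obtains c where "c \<noteq> 0" "x = c * x'" "y = c * y'" "z = c * z'"
proof -
  have "(x, y, z) \<in> proj_point (x', y', z')"
    using proj_point_mem[of "(x, y, z)"] unfolding assms .
  then show thesis using that by (auto simp: proj_point_def)
qed

lemma proj_point_scale:
  assumes "c \<noteq> 0"
  shows "proj_point (c * x, c * y, c * z) = proj_point (x, y, z)"
proof
  show "proj_point (c * x, c * y, c * z) \<subseteq> proj_point (x, y, z)"
  proof
    fix p assume "p \<in> proj_point (c * x, c * y, c * z)"
    then obtain k where "k \<noteq> 0" "p = (k * (c * x), k * (c * y), k * (c * z))"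
      by (auto simp: proj_point_def)
    then show "p \<in> proj_point (x, y, z)"
      using assms unfolding proj_point_def by (auto simp: mult.assoc intro!: exI[of _ "k * c"])
  qed
  show "proj_point (x, y, z) \<subseteq> proj_point (c * x, c * y, c * z)"
  proof
    fix p assume "p \<in> proj_point (x, y, z)"
    then obtain k where "k \<noteq> 0" "p = (k * x, k * y, k * z)" by (auto simp: proj_point_def)
    then show "p \<in> proj_point (c * x, c * y, c * z)"
      using assms unfolding proj_point_def by (auto intro!: exI[of _ "k / c"])
  qed
qed

text \<open>The equation is homogeneous of degree 3, so its validity does not depend on the chosen
  coordinate vector.\<close>

lemma proj_point_mem_weierstrass_iff:
  "proj_point (x, y, z) \<in> weierstrass_curve a4 a6 \<longleftrightarrow>
    (x, y, z) \<noteq> (0, 0, 0) \<and> y\<^sup>2 * z = x ^ 3 + to_ac a4 * x * z\<^sup>2 + to_ac a6 * z ^ 3"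
proof
  assume "proj_point (x, y, z) \<in> weierstrass_curve a4 a6"
  then obtain x' y' z' where eq: "proj_point (x, y, z) = proj_point (x', y', z')"
    and n: "(x', y', z') \<noteq> (0, 0, 0)"
    and w: "y'\<^sup>2 * z' = x' ^ 3 + to_ac a4 * x' * z'\<^sup>2 + to_ac a6 * z' ^ 3"
    by (auto simp: weierstrass_curve_def)
  obtain c where c: "c \<noteq> 0" "x = c * x'" "y = c * y'" "z = c * z'"
    by (rule proj_point_eqD[OF eq])
  have "c ^ 3 * (y'\<^sup>2 * z') = c ^ 3 * (x' ^ 3 + to_ac a4 * x' * z'\<^sup>2 + to_ac a6 * z' ^ 3)"
    using w by simp
  then have "y\<^sup>2 * z = x ^ 3 + to_ac a4 * x * z\<^sup>2 + to_ac a6 * z ^ 3"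
    unfolding c by (simp add: algebra_simps power2_eq_square power3_eq_cube)
  then show "(x, y, z) \<noteq> (0, 0, 0) \<and> y\<^sup>2 * z = x ^ 3 + to_ac a4 * x * z\<^sup>2 + to_ac a6 * z ^ 3"
    using n c by auto
qed (auto simp: weierstrass_curve_def)

definition cubic_poly :: "'a::field \<Rightarrow> 'a \<Rightarrow> 'a alg_closure poly" where
  "cubic_poly a4 a6 = [:to_ac a6, to_ac a4, 0, 1:]"

lemma poly_cubic_poly: "poly (cubic_poly a4 a6) x = x ^ 3 + to_ac a4 * x + to_ac a6"
  by (simp add: cubic_poly_def algebra_simps power3_eq_cube)

lemma degree_cubic_poly: "degree (cubic_poly a4 a6) = 3"
  by (simp add: cubic_poly_def)

lemma affine_point_mem_iff:
  "proj_point (x, y, 1) \<in> weierstrass_curve a4 a6 \<longleftrightarrow> y\<^sup>2 = poly (cubic_poly a4 a6) x"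
  by (simp add: proj_point_mem_weierstrass_iff poly_cubic_poly)

lemma affine_point_eqD:
  assumes "proj_point (x, y, 1) = proj_point (x', y', 1)"
  shows "x = x'" "y = y'"
  using assms by (auto elim!: proj_point_eqD)

lemma affine_point_ne_O: "proj_point (x, y, 1) \<noteq> point_O"
  unfolding point_O_def by (auto elim!: proj_point_eqD)

lemma point_O_mem: "point_O \<in> weierstrass_curve a4 a6"
  unfolding point_O_def by (simp add: proj_point_mem_weierstrass_iff)

text \<open>On the line \<open>z = 0\<close> the equation forces \<open>x = 0\<close>, so
  \<open>point_O\<close> is the only point at infinity.\<close>

lemma weierstrass_curve_cases:
  assumes "P \<in> weierstrass_curve a4 a6"
  obtains "P = point_O"
  | x y where "P = proj_point (x, y, 1)" "y\<^sup>2 = poly (cubic_poly a4 a6) x"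
proof -
  obtain x y z where P: "P = proj_point (x, y, z)" and n: "(x, y, z) \<noteq> (0, 0, 0)"
    and w: "y\<^sup>2 * z = x ^ 3 + to_ac a4 * x * z\<^sup>2 + to_ac a6 * z ^ 3"
    using assms by (auto simp: weierstrass_curve_def)
  show thesis
  proof (cases "z = 0")
    case True
    then have "x = 0" "y \<noteq> 0" using w n by auto
    then show thesis using that(1) proj_point_scale[of y 0 1 0] P True by (simp add: point_O_def)
  next
    case False
    then have "P = proj_point (x / z, y / z, 1)"
      using proj_point_scale[of z "x / z" "y / z" 1] P by simp
    then show thesis using that(2) assms affine_point_mem_iff by blast
  qed
qed

text \<open>The assumption \<open>aff\<close> says that affine points go to affine points. An
  isomorphism fixing \<open>point_O\<close> satisfies it by injectivity.\<close>

context
  fixes a4 a6 b4 b6 :: "'a::field" and \<phi>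
  assumes two: "(2 :: 'a) \<noteq> 0"
    and mor: "morphism_over_base (weierstrass_curve a4 a6) (weierstrass_curve b4 b6) \<phi>"
    and aff: "\<And>x y. y\<^sup>2 = poly (cubic_poly a4 a6) x \<Longrightarrow> \<phi> (proj_point (x, y, 1)) \<noteq> point_O"
begin

interpretation cubic "cubic_poly a4 a6"
proof
  have "to_ac (2 :: 'a) \<noteq> 0" using two by (simp only: to_ac_eq_0_iff not_False_eq_True)
  then show "(2 :: 'a alg_closure) \<noteq> 0" by simp
qed (rule degree_cubic_poly)

lemma regular_form_eval: "regular (\<lambda>x y. form_eval n c (x, y, 1))"
  unfolding form_eval_def prod.case
  by (intro regular_sum regular_mult regular_power regular_const regular_x regular_y)

lemma morphism_affine_point_mem:
  assumes "y\<^sup>2 = poly (cubic_poly a4 a6) x"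
  shows "\<phi> (proj_point (x, y, 1)) \<in> weierstrass_curve b4 b6"
proof -
  have "proj_point (x, y, 1) \<in> weierstrass_curve a4 a6" using assms by (simp only: affine_point_mem_iff)
  moreover have "\<phi> ` weierstrass_curve a4 a6 \<subseteq> weierstrass_curve b4 b6"
    using mor unfolding morphism_over_base_def by (rule conjunct1)
  ultimately show ?thesis by (simp only: image_subset_iff)
qed

text \<open>The coordinates are only known to be regular over the algebraic closure; the last clause
  records that they are locally fractions over the base field.\<close>

lemma morphism_affine_coordinates:
  obtains u v where
    "\<And>x y. y\<^sup>2 = poly (cubic_poly a4 a6) x \<Longrightarrow>
       \<phi> (proj_point (x, y, 1)) = proj_point (ev u x y, ev v x y, 1) \<and>
       (ev v x y)\<^sup>2 = poly (cubic_poly b4 b6) (ev u x y)"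
    "\<And>x y. y\<^sup>2 = poly (cubic_poly a4 a6) x \<Longrightarrow>
       \<exists>n f g h. form_eval n h (x, y, 1) \<noteq> 0 \<and> (\<forall>x y. y\<^sup>2 = poly (cubic_poly a4 a6) x \<longrightarrow>
          ev u x y * form_eval n h (x, y, 1) = form_eval n f (x, y, 1) \<and>
          ev v x y * form_eval n h (x, y, 1) = form_eval n g (x, y, 1))"
proof -
  let ?f = "cubic_poly a4 a6"
  \<comment> \<open>Arguments off the curve are left unconstrained, so that choice yields total
    coordinate functions.\<close>
  have "\<exists>p. y\<^sup>2 = poly ?f x \<longrightarrow> \<phi> (proj_point (x, y, 1)) = proj_point (fst p, snd p, 1)" for x y
  proof (cases "y\<^sup>2 = poly ?f x")
    case True
    then have "\<phi> (proj_point (x, y, 1)) \<in> weierstrass_curve b4 b6"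
      by (rule morphism_affine_point_mem)
    then show ?thesis by (rule weierstrass_curve_cases) (use aff[OF True] in auto)
  qed simp
  then have "\<forall>x y. \<exists>p. y\<^sup>2 = poly ?f x \<longrightarrow> \<phi> (proj_point (x, y, 1)) = proj_point (fst p, snd p, 1)"
    by (intro allI)
  then obtain c where c: "\<forall>x y. y\<^sup>2 = poly ?f x \<longrightarrow>
      \<phi> (proj_point (x, y, 1)) = proj_point (fst (c x y), snd (c x y), 1)"
    unfolding choice_iff by (rule exE)
  define \<xi> \<eta> where "\<xi> = (\<lambda>x y. fst (c x y))" and "\<eta> = (\<lambda>x y. snd (c x y))"
  have coords: "\<phi> (proj_point (x, y, 1)) = proj_point (\<xi> x y, \<eta> x y, 1)" if "y\<^sup>2 = poly ?f x" for x y
    using c that by (simp add: \<xi>_def \<eta>_def)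
  have local: "\<exists>n f g h. form_eval n h (x, y, 1) \<noteq> 0 \<and> (\<forall>x y. y\<^sup>2 = poly ?f x \<longrightarrow>
          \<xi> x y * form_eval n h (x, y, 1) = form_eval n f (x, y, 1) \<and>
          \<eta> x y * form_eval n h (x, y, 1) = form_eval n g (x, y, 1))"
    if on: "y\<^sup>2 = poly ?f x" for x y
  proof -
    have "proj_point (x, y, 1) \<in> weierstrass_curve a4 a6" using on by (simp only: affine_point_mem_iff)
    moreover have "(x, y, 1 :: 'a alg_closure) \<noteq> (0, 0, 0)" by simp
    ultimately obtain n f g h where
      nz: "(form_eval n f (x, y, 1), form_eval n g (x, y, 1), form_eval n h (x, y, 1)) \<noteq> (0, 0, 0)"
      and loc: "\<And>w. w \<noteq> (0, 0, 0) \<Longrightarrow> proj_point w \<in> weierstrass_curve a4 a6 \<Longrightarrow>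
        (form_eval n f w, form_eval n g w, form_eval n h w) \<noteq> (0, 0, 0) \<Longrightarrow>
        \<phi> (proj_point w) = proj_point (form_eval n f w, form_eval n g w, form_eval n h w)"
      using mor[unfolded morphism_over_base_def, THEN conjunct2, rule_format, of "(x, y, 1)"]
      by blast
    have eqs: "form_eval n h (x, y, 1) \<noteq> 0 \<and>
          \<xi> x y * form_eval n h (x, y, 1) = form_eval n f (x, y, 1) \<and>
          \<eta> x y * form_eval n h (x, y, 1) = form_eval n g (x, y, 1)"
      if on: "y\<^sup>2 = poly ?f x"
        and nz: "(form_eval n f (x, y, 1), form_eval n g (x, y, 1), form_eval n h (x, y, 1)) \<noteq> (0, 0, 0)"
      for x y
    proof -
      have "proj_point (form_eval n f (x, y, 1), form_eval n g (x, y, 1), form_eval n h (x, y, 1)) =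
          proj_point (\<xi> x y, \<eta> x y, 1)"
        using loc[of "(x, y, 1)"] on nz coords[OF on] affine_point_mem_iff[of x y a4 a6] by simp
      then show ?thesis by (rule proj_point_eqD) simp
    qed
    \<comment> \<open>Where all three forms vanish, both equations read \<open>0 = 0\<close>; hence
      they hold on the whole affine curve and not only near the given point.\<close>
    have "\<xi> x y * form_eval n h (x, y, 1) = form_eval n f (x, y, 1) \<and>
          \<eta> x y * form_eval n h (x, y, 1) = form_eval n g (x, y, 1)"
      if on: "y\<^sup>2 = poly ?f x" for x y
      by (cases "(form_eval n f (x, y, 1), form_eval n g (x, y, 1), form_eval n h (x, y, 1)) = (0, 0, 0)")
        (use eqs[OF on] in simp_all)
    then show ?thesis using eqs[OF on nz] by blast
  qed
  have "regular \<xi>"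
  proof (rule regular_if_locally_fraction)
    fix x y :: "'a alg_closure" assume "y\<^sup>2 = poly ?f x"
    then obtain n f h where h: "form_eval n h (x, y, 1) \<noteq> 0"
      "\<And>x y. y\<^sup>2 = poly ?f x \<Longrightarrow> \<xi> x y * form_eval n h (x, y, 1) = form_eval n f (x, y, 1)"
      using local by meson
    then have "regular (\<lambda>x y. \<xi> x y * form_eval n h (x, y, 1))"
      using regular_form_eval[of n f] unfolding regular_def by simp
    then show "\<exists>h. regular h \<and> h x y \<noteq> 0 \<and> regular (\<lambda>x y. \<xi> x y * h x y)"
      using h(1) regular_form_eval[of n h] by (intro exI[of _ "\<lambda>x y. form_eval n h (x, y, 1)"]) simp
  qed
  then obtain u where u: "\<And>x y. y\<^sup>2 = poly ?f x \<Longrightarrow> \<xi> x y = ev u x y"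
    unfolding regular_def by blast
  have "regular \<eta>"
  proof (rule regular_if_locally_fraction)
    fix x y :: "'a alg_closure" assume "y\<^sup>2 = poly ?f x"
    then obtain n g h where h: "form_eval n h (x, y, 1) \<noteq> 0"
      "\<And>x y. y\<^sup>2 = poly ?f x \<Longrightarrow> \<eta> x y * form_eval n h (x, y, 1) = form_eval n g (x, y, 1)"
      using local by meson
    then have "regular (\<lambda>x y. \<eta> x y * form_eval n h (x, y, 1))"
      using regular_form_eval[of n g] unfolding regular_def by simp
    then show "\<exists>h. regular h \<and> h x y \<noteq> 0 \<and> regular (\<lambda>x y. \<eta> x y * h x y)"
      using h(1) regular_form_eval[of n h] by (intro exI[of _ "\<lambda>x y. form_eval n h (x, y, 1)"]) simp
  qed
  then obtain v where v: "\<And>x y. y\<^sup>2 = poly ?f x \<Longrightarrow> \<eta> x y = ev v x y"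
    unfolding regular_def by blast
  show thesis
  proof (rule that[of u v])
    fix x y assume on: "y\<^sup>2 = poly ?f x"
    have eq: "\<phi> (proj_point (x, y, 1)) = proj_point (ev u x y, ev v x y, 1)"
      using coords[OF on] u[OF on] v[OF on] by simp
    moreover have "\<phi> (proj_point (x, y, 1)) \<in> weierstrass_curve b4 b6"
      using on by (rule morphism_affine_point_mem)
    ultimately show "\<phi> (proj_point (x, y, 1)) = proj_point (ev u x y, ev v x y, 1) \<and>
       (ev v x y)\<^sup>2 = poly (cubic_poly b4 b6) (ev u x y)"
      using affine_point_mem_iff by metis
    show "\<exists>n f g h. form_eval n h (x, y, 1) \<noteq> 0 \<and> (\<forall>x y. y\<^sup>2 = poly ?f x \<longrightarrow>
          ev u x y * form_eval n h (x, y, 1) = form_eval n f (x, y, 1) \<and>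
          ev v x y * form_eval n h (x, y, 1) = form_eval n g (x, y, 1))"
      using local[OF on] by (simp add: u v)
  qed
qed

end

section \<open>Frobenius and descent to the base field\<close>

lemma three_eq_0_alg_closure:
  assumes "(3 :: 'a::field) = 0"
  shows "(3 :: 'a alg_closure) = 0"
  using arg_cong[OF assms, of to_ac] by simp

lemma two_ne_0:
  assumes "(3 :: 'b::field) = 0"
  shows "(2 :: 'b) \<noteq> 0"
proof
  assume "(2 :: 'b) = 0"
  moreover have "(3 :: 'b) = 2 + 1" by simp
  ultimately show False using assms by simp
qed

lemma frobenius_3_sum:
  fixes F :: "'i \<Rightarrow> 'b::comm_ring_1"
  assumes "(3 :: 'b) = 0"
  shows "(\<Sum>i\<in>I. F i) ^ (3 ^ n) = (\<Sum>i\<in>I. F i ^ (3 ^ n))"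
  by (induction I rule: infinite_finite_induct) (simp_all add: frobenius_3_add[OF assms] zero_power)

lemma to_ac_frobenius:
  assumes "card (UNIV :: 'a::{field,finite} set) = 3 ^ d"
  shows "to_ac (c :: 'a) ^ (3 ^ d) = to_ac c"
  using finite_field_power_card[of c] unfolding assms by (metis to_ac_power)

text \<open>The polynomial \<open>X ^ q - X\<close> has at most \<open>q\<close> roots, and the
  \<open>q\<close> elements of the base field already are roots.\<close>

lemma frobenius_fixed_imp_in_base:
  fixes c :: "'a::{field,finite} alg_closure"
  assumes "c ^ card (UNIV :: 'a set) = c"
  shows "c \<in> range to_ac"
proof -
  let ?q = "card (UNIV :: 'a set)"
  let ?p = "monom 1 ?q - [:0, 1 :: 'a alg_closure:]"
  have "card {0, 1 :: 'a} \<le> ?q" by (intro card_mono) auto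
  then have "?q > 1" by simp
  then have deg: "degree ?p = ?q"
    unfolding diff_conv_add_uminus by (subst degree_add_eq_left) (simp_all add: degree_monom_eq)
  then have "?p \<noteq> 0" using \<open>?q > 1\<close> by auto
  have roots: "{z. poly ?p z = 0} = {z. z ^ ?q = z}" by (simp add: poly_monom)
  have fin: "finite {z :: 'a alg_closure. z ^ ?q = z}"
    using poly_roots_finite[OF \<open>?p \<noteq> 0\<close>] unfolding roots .
  have "card {z :: 'a alg_closure. z ^ ?q = z} \<le> ?q"
    using card_poly_roots_bound[OF \<open>?p \<noteq> 0\<close>] unfolding roots deg .
  moreover have "card (range (to_ac :: 'a \<Rightarrow> _)) = ?q" by (rule card_image[OF inj_to_ac])
  ultimately have "range to_ac = {z :: 'a alg_closure. z ^ ?q = z}"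
    using finite_field_power_card fin
    by (intro card_seteq) (auto simp flip: to_ac_power)
  then show ?thesis using assms by blast
qed

text \<open>The coefficients lie in the base field and are fixed by the \<open>q\<close>-th power
  map, which is additive and multiplicative.\<close>

lemma form_eval_frobenius:
  fixes c :: "nat \<Rightarrow> nat \<Rightarrow> 'a::{field,finite}"
  assumes "card (UNIV :: 'a set) = 3 ^ d"
  shows "form_eval n c (x ^ 3 ^ d, y ^ 3 ^ d, 1) = form_eval n c (x, y, 1) ^ 3 ^ d"
proof -
  have three: "(3 :: 'a alg_closure) = 0"
    by (rule three_eq_0_alg_closure[OF three_eq_0_if_card[OF assms]])
  show ?thesis
    unfolding form_eval_def prod.case frobenius_3_sum[OF three] power_mult_distrib
      to_ac_frobenius[OF assms]
    by (simp add: power_mult[symmetric] mult.commute)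
qed

lemma isomorphic_over_base_imp_scaling:
  fixes a4 a6 b4 b6 :: "'a::{field,finite}"
  assumes card: "card (UNIV :: 'a set) = 3 ^ d"
    and iso: "isomorphic_over_base a4 a6 b4 b6"
  obtains u where "u \<noteq> 0" "b4 = u ^ 4 * a4"
proof -
  let ?f = "cubic_poly a4 a6" and ?g = "cubic_poly b4 b6" and ?q = "3 ^ d :: nat"
  let ?C = "weierstrass_curve a4 a6" and ?D = "weierstrass_curve b4 b6"
  have three: "(3 :: 'a) = 0" by (rule three_eq_0_if_card[OF card])
  note two_base = two_ne_0[OF three]
  have three': "(3 :: 'a alg_closure) = 0" by (rule three_eq_0_alg_closure[OF three])
  note two' = two_ne_0[OF three']
  interpret cubic ?f by unfold_locales (rule degree_cubic_poly, rule two')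
  obtain \<phi> \<psi> where mor: "morphism_over_base ?C ?D \<phi>" "morphism_over_base ?D ?C \<psi>"
    and inv_ball: "\<forall>P\<in>?C. \<psi> (\<phi> P) = P" "\<forall>Q\<in>?D. \<phi> (\<psi> Q) = Q"
    and O: "\<phi> point_O = point_O"
    using iso unfolding isomorphic_over_base_def by (elim exE conjE) (rule that)
  note inv = inv_ball[rule_format]
  have O': "\<psi> point_O = point_O" using inv(1)[OF point_O_mem] O by simp
  have aff: "\<phi> (proj_point (x, y, 1)) \<noteq> point_O" if "y\<^sup>2 = poly ?f x" for x y
    using inv(1)[of "proj_point (x, y, 1)"] that affine_point_ne_O[of x y] O'
    by (auto simp: affine_point_mem_iff)
  have aff': "\<psi> (proj_point (x, y, 1)) \<noteq> point_O" if "y\<^sup>2 = poly ?g x" for x y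
    using inv(2)[of "proj_point (x, y, 1)"] that affine_point_ne_O[of x y] O
    by (auto simp: affine_point_mem_iff)
  obtain u v where uv: "\<And>x y. y\<^sup>2 = poly ?f x \<Longrightarrow>
       \<phi> (proj_point (x, y, 1)) = proj_point (ev u x y, ev v x y, 1) \<and>
       (ev v x y)\<^sup>2 = poly ?g (ev u x y)"
    and loc: "\<And>x y. y\<^sup>2 = poly ?f x \<Longrightarrow>
       \<exists>n f g h. form_eval n h (x, y, 1) \<noteq> 0 \<and> (\<forall>x y. y\<^sup>2 = poly ?f x \<longrightarrow>
          ev u x y * form_eval n h (x, y, 1) = form_eval n f (x, y, 1) \<and>
          ev v x y * form_eval n h (x, y, 1) = form_eval n g (x, y, 1))"
    by (rule morphism_affine_coordinates[OF two_base mor(1)], erule aff, rule that)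
  obtain s t where st: "\<And>x y. y\<^sup>2 = poly ?g x \<Longrightarrow>
       \<psi> (proj_point (x, y, 1)) = proj_point (ev s x y, ev t x y, 1) \<and>
       (ev t x y)\<^sup>2 = poly ?f (ev s x y)"
    by (rule morphism_affine_coordinates[OF two_base mor(2)], erule aff', rule that)
  have round_trip: "proj_point (ev s (ev u x y) (ev v x y), ev t (ev u x y) (ev v x y), 1) = proj_point (x, y, 1)"
    if on: "y\<^sup>2 = poly ?f x" for x y
  proof -
    have "proj_point (x, y, 1) \<in> ?C" using on by (simp only: affine_point_mem_iff)
    then have "\<psi> (\<phi> (proj_point (x, y, 1))) = proj_point (x, y, 1)" by (rule inv(1))
    then show ?thesis using uv[OF on] st by simp
  qed
  obtain c r a b e where c: "c \<noteq> 0" and e: "e \<noteq> 0" and u: "u = ([:r, c:], 0)"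
    and v: "v = ([:b, a:], [:e:])"
  proof (rule invertible_coordinate_change_affine[OF degree_cubic_poly])
    show "(ev v x y)\<^sup>2 = poly ?g (ev u x y)" if "y\<^sup>2 = poly ?f x" for x y
      using uv[OF that] by simp
    show "ev s (ev u x y) (ev v x y) = x" if "y\<^sup>2 = poly ?f x" for x y
      using affine_point_eqD(1)[OF round_trip[OF that]] .
    show "ev t (ev u x y) (ev v x y) = y" if "y\<^sup>2 = poly ?f x" for x y
      using affine_point_eqD(2)[OF round_trip[OF that]] .
  qed

  \<comment> \<open>The target equation, pulled back to the source, is an identity in the coordinate
    ring. Its \<open>y\<close> component kills \<open>a\<close> and \<open>b\<close>; the other
    compares polynomials in \<open>x\<close>.\<close>
  have "mul v v = (pcompose ?g [:r, c:], 0)"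
  proof (rule ev_inject)
    fix x y assume on: "y\<^sup>2 = poly ?f x"
    have "ev (mul v v) x y = poly ?g (ev u x y)"
      using uv[OF on] by (simp add: ev_mul[OF on] power2_eq_square)
    then show "ev (mul v v) x y = ev (pcompose ?g [:r, c:], 0) x y"
      by (simp add: u ev_def poly_pcompose)
  qed
  then have V: "[:b, a:] * [:b, a:] + ?f * [:e:] * [:e:] = pcompose ?g [:r, c:]"
    and W: "[:b, a:] * [:e:] + [:e:] * [:b, a:] = 0"
    unfolding v mul_def by simp_all
  have "2 * e * b = 0" "2 * e * a = 0" using W by (simp_all add: algebra_simps)
  then have ab: "a = 0" "b = 0" using two' e by simp_all
  \<comment> \<open>Coefficients of \<open>x ^ 3\<close> and \<open>x\<close> in
    \<open>e\<^sup>2 f(x) = g(c x + r)\<close>; in characteristic 3 the cube of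
    \<open>c x + r\<close> contributes nothing to the latter.\<close>
  have coeffs: "e * e = c * (c * c)" "e * (e * to_ac a4) = c * to_ac b4"
    using V unfolding ab cubic_poly_def by (simp_all add: pcompose_pCons algebra_simps three')
  have ec: "e\<^sup>2 = c ^ 3" "e\<^sup>2 * to_ac a4 = to_ac b4 * c"
    using coeffs(1) by (simp add: power2_eq_square power3_eq_cube mult.assoc)
      (use coeffs(2) in \<open>simp only: power2_eq_square mult.assoc mult.commute[of _ c]\<close>)

  have frob: "ev u (x ^ ?q) (y ^ ?q) = ev u x y ^ ?q \<and> ev v (x ^ ?q) (y ^ ?q) = ev v x y ^ ?q"
    if on: "y\<^sup>2 = poly ?f x" for x y
  proof -
    have on': "(y ^ ?q)\<^sup>2 = poly ?f (x ^ ?q)"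
    proof -
      have "(y ^ ?q)\<^sup>2 = (y\<^sup>2) ^ ?q" by (simp add: power_mult[symmetric] mult.commute)
      also have "\<dots> = (x ^ 3) ^ ?q + to_ac a4 ^ ?q * x ^ ?q + to_ac a6 ^ ?q"
        unfolding on poly_cubic_poly frobenius_3_add[OF three'] power_mult_distrib ..
      finally show ?thesis unfolding to_ac_frobenius[OF card] poly_cubic_poly
        by (simp add: power_mult[symmetric] mult.commute)
    qed
    obtain n f g h where h: "form_eval n h (x, y, 1) \<noteq> 0"
      and fgh: "\<And>x y. y\<^sup>2 = poly ?f x \<Longrightarrow>
          ev u x y * form_eval n h (x, y, 1) = form_eval n f (x, y, 1) \<and>
          ev v x y * form_eval n h (x, y, 1) = form_eval n g (x, y, 1)"
      using loc[OF on] by blast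
    \<comment> \<open>The fraction valid at \<open>(x, y)\<close> is also used at its Frobenius
      image, where the denominator is the \<open>q\<close>-th power of a non-zero value.\<close>
    have "ev u (x ^ ?q) (y ^ ?q) * form_eval n h (x, y, 1) ^ ?q = ev u x y ^ ?q * form_eval n h (x, y, 1) ^ ?q"
      "ev v (x ^ ?q) (y ^ ?q) * form_eval n h (x, y, 1) ^ ?q = ev v x y ^ ?q * form_eval n h (x, y, 1) ^ ?q"
      using fgh[OF on'] fgh[OF on] unfolding form_eval_frobenius[OF card]
      by (simp_all flip: power_mult_distrib)
    then show ?thesis using h by simp
  qed
  have ru: "r + c * x ^ ?q = r ^ ?q + c ^ ?q * x ^ ?q" for x
  proof -
    obtain y where "y\<^sup>2 = poly ?f x" using square_root_exists by blast
    then have "ev u (x ^ ?q) (y ^ ?q) = ev u x y ^ ?q" using frob by blast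
    then show ?thesis unfolding u
      by (simp add: ev_def frobenius_3_add[OF three'] power_mult_distrib mult.commute)
  qed
  have "r ^ ?q = r" using ru[of 0] by (simp add: zero_power)
  then have "c ^ ?q = c" using ru[of 1] by simp
  then obtain c' where c': "c = to_ac c'" using frobenius_fixed_imp_in_base[of c] card by auto
  \<comment> \<open>A point with \<open>y \<noteq> 0\<close> is needed to cancel
    \<open>y ^ q\<close> when comparing \<open>e\<close> with \<open>e ^ q\<close>.\<close>
  have "\<exists>x. poly ?f x \<noteq> 0"
    using f_nonzero poly_eqI_alg_closed[of ?f 0] by auto
  then obtain x y where on: "y\<^sup>2 = poly ?f x" and "y \<noteq> 0"
    using square_root_exists by (metis zero_power2)
  have "e * y ^ ?q = e ^ ?q * y ^ ?q"
    using frob[OF on] unfolding v ab by (simp add: ev_def power_mult_distrib)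
  then have "e ^ ?q = e" using \<open>y \<noteq> 0\<close> by simp
  then obtain e' where e': "e = to_ac e'" using frobenius_fixed_imp_in_base[of e] card by auto
  have nz: "c' \<noteq> 0" "e' \<noteq> 0" using c e c' e' by auto
  have "to_ac (e'\<^sup>2) = to_ac (c' ^ 3)" "to_ac (e'\<^sup>2 * a4) = to_ac (b4 * c')"
    using ec by (simp_all add: c' e')
  then have ec': "e'\<^sup>2 = c' ^ 3" "e'\<^sup>2 * a4 = b4 * c'" by (simp_all only: to_ac_eq_iff)
  \<comment> \<open>Because \<open>e'\<^sup>2 = c' ^ 3\<close>, the quotient
    \<open>u = e' / c'\<close> has \<open>u\<^sup>2 = c'\<close> and \<open>u ^ 3 = e'\<close>: it
    is the usual scaling parameter.\<close>
  have "(e' / c') ^ 4 * a4 = e'\<^sup>2 * (e'\<^sup>2 * a4) / c' ^ 4"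
    by (simp add: power_divide power4_eq_xxxx power2_eq_square)
  also have "\<dots> = c' ^ 3 * (b4 * c') / c' ^ 4" unfolding ec'(2) unfolding ec'(1) ..
  also have "\<dots> = b4" using nz by (simp add: power3_eq_cube power4_eq_xxxx)
  finally have "b4 = (e' / c') ^ 4 * a4" by simp
  then show thesis using that[of "e' / c'"] nz by simp
qed

section \<open>Affine changes of coordinates\<close>

text \<open>The substitution \<open>(x, y)\<close> to \<open>(u\<^sup>2 x + r, u ^ 3 y)\<close> made
  homogeneous. It is linear on coordinate vectors, so its image map sends projective points to
  projective points.\<close>

definition affine_change :: "'a::field \<Rightarrow> 'a \<Rightarrow> 'a alg_closure triple \<Rightarrow> 'a alg_closure triple" where
  "affine_change u r = (\<lambda>(x, y, z). (to_ac (u\<^sup>2) * x + to_ac r * z, to_ac (u ^ 3) * y, z))"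

lemma affine_change_proj_point:
  "affine_change u r ` proj_point v = proj_point (affine_change u r v)"
proof -
  obtain x y z where v: "v = (x, y, z)" by (cases v)
  have "affine_change u r (k * x, k * y, k * z) =
      (k * (to_ac (u\<^sup>2) * x + to_ac r * z), k * (to_ac (u ^ 3) * y), k * z)" for k
    by (simp add: affine_change_def algebra_simps)
  moreover have "affine_change u r v = (to_ac (u\<^sup>2) * x + to_ac r * z, to_ac (u ^ 3) * y, z)"
    by (simp add: v affine_change_def)
  ultimately show ?thesis
    unfolding v proj_point_def by (simp only: prod.case setcompr_eq_image image_image)
qed

lemma affine_change_inverse:
  assumes "u \<noteq> 0"
  shows "affine_change (1 / u) (- r / u\<^sup>2) (affine_change u r v) = v"
  using assms by (cases v) (simp add: affine_change_def field_simps power2_eq_square power3_eq_cube)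

lemma affine_change_ne_0:
  assumes "u \<noteq> 0" "v \<noteq> (0, 0, 0)"
  shows "affine_change u r v \<noteq> (0, 0, 0)"
  using assms by (cases v) (auto simp: affine_change_def)

text \<open>Multiply the source equation by \<open>u ^ 6\<close>. Cubing is additive, so the shift
  by \<open>r\<close> produces no \<open>x\<^sup>2\<close> term; the hypotheses on \<open>b4\<close>
  and \<open>b6\<close> match the linear and constant terms.\<close>

lemma affine_change_morphism:
  fixes a4 a6 b4 b6 u r :: "'a::field"
  assumes three: "(3 :: 'a) = 0" and u: "u \<noteq> 0"
    and b4: "b4 = u ^ 4 * a4" and b6: "r ^ 3 + b4 * r + b6 = u ^ 6 * a6"
  shows "morphism_over_base (weierstrass_curve a4 a6) (weierstrass_curve b4 b6) (image (affine_change u r))"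
  unfolding morphism_over_base_def
proof (intro conjI allI impI)
  show "image (affine_change u r) ` weierstrass_curve a4 a6 \<subseteq> weierstrass_curve b4 b6"
  proof (intro image_subsetI)
    fix P assume "P \<in> weierstrass_curve a4 a6"
    then obtain x y z where P: "P = proj_point (x, y, z)" and n: "(x, y, z) \<noteq> (0, 0, 0)"
      and w: "y\<^sup>2 * z = x ^ 3 + to_ac a4 * x * z\<^sup>2 + to_ac a6 * z ^ 3"
      by (auto simp: weierstrass_curve_def)
    have cube: "(p + q) ^ 3 = p ^ 3 + q ^ 3" for p q :: "'a alg_closure"
      using frobenius_3_add[OF three_eq_0_alg_closure[OF three], of p q 1] by simp
    let ?U = "to_ac u" and ?R = "to_ac r"
    have B4: "to_ac b4 = ?U ^ 4 * to_ac a4" using b4 by simp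
    have "to_ac (r ^ 3 + b4 * r + b6) = to_ac (u ^ 6 * a6)" using b6 by simp
    then have B6: "?R ^ 3 + to_ac b4 * ?R + to_ac b6 = ?U ^ 6 * to_ac a6" by simp
    have "(?U ^ 3 * y)\<^sup>2 * z = ?U ^ 6 * (y\<^sup>2 * z)" by (simp add: power_mult_distrib flip: power_mult)
    also have "\<dots> = ?U ^ 6 * x ^ 3 + ?U ^ 6 * to_ac a4 * x * z\<^sup>2 + (?U ^ 6 * to_ac a6) * z ^ 3"
      unfolding w by (simp add: algebra_simps)
    also have "\<dots> = (?U\<^sup>2 * x) ^ 3 + (?R * z) ^ 3 + to_ac b4 * (?U\<^sup>2 * x + ?R * z) * z\<^sup>2 + to_ac b6 * z ^ 3"
      unfolding B6[symmetric] unfolding B4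
      by (simp add: algebra_simps eval_nat_numeral)
    finally have "(?U ^ 3 * y)\<^sup>2 * z = (?U\<^sup>2 * x + ?R * z) ^ 3 + to_ac b4 * (?U\<^sup>2 * x + ?R * z) * z\<^sup>2 + to_ac b6 * z ^ 3"
      unfolding cube .
    moreover have "affine_change u r (x, y, z) = (?U\<^sup>2 * x + ?R * z, ?U ^ 3 * y, z)"
      by (simp add: affine_change_def)
    ultimately show "affine_change u r ` P \<in> weierstrass_curve b4 b6"
      using affine_change_ne_0[OF u n, of r] unfolding P affine_change_proj_point
      by (simp add: proj_point_mem_weierstrass_iff)
  qed
next
  fix v :: "'a alg_closure triple"
  assume v: "v \<noteq> (0, 0, 0) \<and> proj_point v \<in> weierstrass_curve a4 a6"
  \<comment> \<open>One triple of linear forms serves at every point. In degree 1 the indices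
    \<open>(1, 0)\<close>, \<open>(0, 1)\<close> and \<open>(0, 0)\<close> stand for
    \<open>X\<close>, \<open>Y\<close> and \<open>Z\<close>.\<close>
  define f g h :: "nat \<Rightarrow> nat \<Rightarrow> 'a" where
    "f = (\<lambda>i j. if i = 1 then u\<^sup>2 else if j = 0 then r else 0)" and
    "g = (\<lambda>i j. if i = 0 \<and> j = 1 then u ^ 3 else 0)" and
    "h = (\<lambda>i j. if i = 0 \<and> j = 0 then 1 else 0)"
  have forms: "(form_eval 1 f w, form_eval 1 g w, form_eval 1 h w) = affine_change u r w" for w
    by (cases w) (simp add: form_eval_def affine_change_def f_def g_def h_def)
  show "\<exists>n f g h. (form_eval n f v, form_eval n g v, form_eval n h v) \<noteq> (0, 0, 0) \<and>
         (\<forall>w. w \<noteq> (0, 0, 0) \<and> proj_point w \<in> weierstrass_curve a4 a6 \<and>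
              (form_eval n f w, form_eval n g w, form_eval n h w) \<noteq> (0, 0, 0) \<longrightarrow>
              affine_change u r ` proj_point w = proj_point (form_eval n f w, form_eval n g w, form_eval n h w))"
    by (rule exI[of _ 1], rule exI[of _ f], rule exI[of _ g], rule exI[of _ h])
      (use v affine_change_ne_0[OF u] in \<open>simp only: forms affine_change_proj_point simp_thms\<close>)
qed

lemma isomorphic_over_base_affine_change:
  fixes a4 a6 b4 b6 u r :: "'a::field"
  assumes three: "(3 :: 'a) = 0" and u: "u \<noteq> 0"
    and b4: "b4 = u ^ 4 * a4" and b6: "r ^ 3 + b4 * r + b6 = u ^ 6 * a6"
  shows "isomorphic_over_base a4 a6 b4 b6"
proof -
  define u' r' where "u' = 1 / u" and "r' = - r / u\<^sup>2"
  have u': "u' \<noteq> 0" using u by (simp add: u'_def)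
  have inv: "affine_change u' r' (affine_change u r v) = v" for v
    using u unfolding u'_def r'_def by (rule affine_change_inverse)
  have "- r' / u'\<^sup>2 = r" "1 / u' = u" using u by (simp_all add: u'_def r'_def power_divide)
  then have inv': "affine_change u r (affine_change u' r' v) = v" for v
    using affine_change_inverse[OF u', of r' v] by simp
  have a4: "a4 = u' ^ 4 * b4" using u by (simp add: u'_def b4 power_divide)
  have "b6 = u ^ 6 * a6 - r ^ 3 - u ^ 4 * a4 * r" using b6 unfolding b4 by (simp add: algebra_simps)
  then have a6: "r' ^ 3 + a4 * r' + a6 = u' ^ 6 * b6"
    using u by (simp add: u'_def r'_def field_simps eval_nat_numeral)
  show ?thesis unfolding isomorphic_over_base_def
  proof (intro exI conjI)
    show "morphism_over_base (weierstrass_curve a4 a6) (weierstrass_curve b4 b6) (image (affine_change u r))"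
      by (rule affine_change_morphism[OF assms])
    show "morphism_over_base (weierstrass_curve b4 b6) (weierstrass_curve a4 a6) (image (affine_change u' r'))"
      by (rule affine_change_morphism[OF three u' a4 a6])
    show "affine_change u r ` point_O = point_O"
      using proj_point_scale[of "to_ac (u ^ 3)" 0 1 0] u
      unfolding point_O_def affine_change_proj_point by (simp add: affine_change_def)
  qed (simp_all add: image_image inv inv')
qed

text \<open>Any constant term \<open>b6\<close> can be reached:
  \<open>r ^ 3 + b r = u ^ 6 a6 - b6\<close> with \<open>b = u ^ 4 a4\<close> is solvable because
  its left side is injective in \<open>r\<close> on a finite field.\<close>

lemma isomorphic_over_base_if_scaling:
  fixes a4 a6 u b6 :: "'a::{field,finite}"
  assumes three: "(3 :: 'a) = 0" and u: "u \<noteq> 0" and ns: "\<not> is_square (- (u ^ 4 * a4))"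
  shows "isomorphic_over_base a4 a6 (u ^ 4 * a4) b6"
proof -
  let ?b = "u ^ 4 * a4" let ?h = "\<lambda>r. r ^ 3 + ?b * r"
  have "inj ?h"
  proof (rule injI)
    fix r s assume eq: "?h r = ?h s"
    have "(r - s) ^ 3 = r ^ 3 - s ^ 3 - 3 * (r * s * (r - s))"
      by (simp add: algebra_simps power3_eq_cube)
    then have "(r - s) ^ 3 = r ^ 3 - s ^ 3" using three by simp
    then have "(r - s) ^ 3 + ?b * (r - s) = ?h r - ?h s" by (simp only: right_diff_distrib) simp
    also have "\<dots> = 0" using eq by simp
    finally have "(r - s) ^ 3 + ?b * (r - s) = 0" .
    \<comment> \<open>A zero of the second factor would exhibit \<open>- b\<close> as a
      square.\<close>
    then have "(r - s) * ((r - s)\<^sup>2 + ?b) = 0"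
      by (simp add: algebra_simps power2_eq_square power3_eq_cube)
    moreover have "(r - s)\<^sup>2 + ?b \<noteq> 0"
      using ns by (metis add.inverse_unique add.commute is_nth_power_nth_power)
    ultimately show "r = s" by simp
  qed
  then have "surj ?h" by (rule finite_UNIV_inj_surj[OF finite])
  then obtain r where "u ^ 6 * a6 - b6 = ?h r" by (rule surjE)
  then show ?thesis
    by (intro isomorphic_over_base_affine_change[OF three u refl, of r]) (simp only: diff_eq_eq)
qed

section \<open>Normal forms and invariance of the type\<close>

lemma elliptic_curve_imp_ne_0:
  fixes a4 a6 :: "'a::field"
  assumes "(3 :: 'a) = 0" "elliptic_curve a4 a6"
  shows "a4 \<noteq> 0"
proof
  assume "a4 = 0"
  have three: "(3 :: 'a alg_closure) = 0" by (rule three_eq_0_alg_closure[OF assms(1)])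
  \<comment> \<open>For \<open>a4 = 0\<close> the cubic has a triple root in characteristic 3, and
    \<open>(x, 0)\<close> is a singular point.\<close>
  obtain x where x: "x ^ 3 = - to_ac a6" using nth_root_exists[of 3 "- to_ac a6"] by auto
  have "proj_point (x, 0, 1) \<in> weierstrass_curve a4 a6"
    using x \<open>a4 = 0\<close> by (simp add: proj_point_mem_weierstrass_iff)
  then show False
    using assms(2)[unfolded elliptic_curve_def, rule_format, of x 0 1] \<open>a4 = 0\<close> three by simp
qed

text \<open>Serves both types, with \<open>w = \<beta>\<close> or \<open>w = \<beta> ^ 3\<close>.
  Scaling by \<open>i / t\<close> removes the fourth power \<open>t ^ 4\<close> and, through
  \<open>i ^ 4 = -1\<close>, produces the sign.\<close>

lemma type_III_normal_form:
  fixes a4 a6 i w :: "'a::{field,finite}"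
  assumes "(3 :: 'a) = 0" "i ^ 4 = (-1 :: 'a)" "\<not> is_square (- a4)" "a4 \<in> (\<lambda>t. w * t) ` fourth_powers"
  shows "isomorphic_over_base a4 a6 (- w) 0"
proof -
  obtain t where t: "t \<noteq> 0" "a4 = w * t ^ 4" using assms(4) by (auto simp: fourth_powers_def)
  have i: "i \<noteq> 0" using assms(2) by auto
  have w: "- w = (i / t) ^ 4 * a4" using t assms(2) by (simp add: power_divide)
  \<comment> \<open>Multiplication by a non-zero fourth power preserves non-squares.\<close>
  have "\<not> is_square (- ((i / t) ^ 4 * a4))"
  proof
    assume "is_square (- ((i / t) ^ 4 * a4))"
    then obtain z where "- ((i / t) ^ 4 * a4) = z\<^sup>2" by (auto simp: is_nth_power_def)
    then have "- a4 = (z / (i / t)\<^sup>2)\<^sup>2"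
      using i t(1) by (simp add: power_divide flip: power_mult)(simp add: field_simps)
    then show False using assms(3) by (metis is_nth_power_nth_power)
  qed
  then show ?thesis unfolding w
    using i t(1) by (intro isomorphic_over_base_if_scaling[OF assms(1)]) simp_all
qed

theorem mainTheorem4:
  fixes \<beta> a4 a6 :: "'a :: {field, finite}" and d :: nat
  assumes "card (UNIV :: 'a set) = 3 ^ d" and "even d"
    and "primitive_root \<beta>"
    and "elliptic_curve a4 a6"
  shows "(\<not> is_square (- a4) \<longleftrightarrow> type_IIIa \<beta> a4 \<or> type_IIIb \<beta> a4) \<and>
    (\<not> is_square (- a4) \<longrightarrow>
      (type_IIIa \<beta> a4 \<longrightarrow>
         isomorphic_over_base a4 a6 (- \<beta>) 0 \<and>
         (\<forall>b4 b6. elliptic_curve b4 b6 \<and> isomorphic_over_base a4 a6 b4 b6 \<longrightarrow> type_IIIa \<beta> b4)) \<and>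
      (type_IIIb \<beta> a4 \<longrightarrow> isomorphic_over_base a4 a6 (- (\<beta> ^ 3)) 0))"
proof -
  have three: "(3 :: 'a) = 0" by (rule three_eq_0_if_card[OF assms(1)])
  obtain i :: 'a where i: "i ^ 4 = -1" using neg_one_fourth_power[OF assms(1-3)] by blast
  have "a4 \<noteq> 0" by (rule elliptic_curve_imp_ne_0[OF three assms(4)])
  note iff = nonsquare_iff_type_III[OF two_ne_0[OF three] i assms(3) this]
  \<comment> \<open>An isomorphism changes \<open>a4\<close> by a fourth power only, so the coset
    modulo fourth powers is kept.\<close>
  have "type_IIIa \<beta> b4" if "type_IIIa \<beta> a4" and iso: "isomorphic_over_base a4 a6 b4 b6" for b4 b6
  proof -
    obtain u where u: "u \<noteq> 0" "b4 = u ^ 4 * a4"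
      by (rule isomorphic_over_base_imp_scaling[OF assms(1) iso])
    obtain t where t: "t \<noteq> 0" "a4 = \<beta> * t ^ 4"
      using \<open>type_IIIa \<beta> a4\<close> by (auto simp: type_IIIa_def fourth_powers_def)
    have "b4 = \<beta> * (u * t) ^ 4" using u t by (simp add: power_mult_distrib)
    moreover have "(u * t) ^ 4 \<in> fourth_powers"
      using u t unfolding fourth_powers_def by (intro CollectI exI[of _ "u * t"]) simp
    ultimately show ?thesis unfolding type_IIIa_def by (rule image_eqI)
  qed
  then show ?thesis
    using iff type_III_normal_form[OF three i] unfolding type_IIIa_def type_IIIb_def by blast
qed

end
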